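(* Let $m$ be a positive even integer and $n$ a positive integer. Then $$U(m,n)^*=HPSD(m,n)\quad\text{and}\quad HPSD(m,n)^*=U(m,n).$$
   Context: For $\mathbf{x}=(x_0,\dots,x_p)^\top$ and $\mathbf{y}=(y_0,\dots,y_q)^\top$ real vectors, the convolution $\mathbf{x}*\mathbf{y}\in\mathbb{R}^{p+q+1}$ has entries $(\mathbf{x}*\mathbf{y})_i=\sum_{i_1+i_2=i,\,0\le i_1\le p,\,0\le i_2\le q}x_{i_1}y_{i_2}$, $i=0,\dots,p+q$. For $\mathbf{x}\in\mathbb{R}^n$, $\mathbf{x}^{*m}=\mathbf{x}*\cdots*\mathbf{x}$ ($m$ factors) $\in\mathbb{R}^{(n-1)m+1}$. The symbol $\bullet$ denotes the standard inner product. Define $HPSD(m,n)=\{\mathbf{v}\in\mathbb{R}^{(n-1)m+1}: \mathbf{v}\bullet\mathbf{x}^{*m}\ge 0\text{ for all }\mathbf{x}\in\mathbb{R}^n\}$ and $U(m,n)=\operatorname{conv}\{\mathbf{x}^{*m}:\mathbf{x}\in\mathbb{R}^n\}$ (convex hull) in $\mathbb{R}^{(n-1)m+1}$. For a set $S\subseteq\mathbb{R}^N$, its dual cone is $S^*=\{\mathbf{y}\in\mathbb{R}^N:\mathbf{y}\bullet\mathbf{x}\ge 0\text{ for all }\mathbf{x}\in S\}$. *)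

theory Defs
  imports Complex_Main "Jordan_Normal_Form.Matrix"
begin

text \<open>
  The ambient dimension \<open>(n - 1) * m + 1\<close> depends on \<open>m\<close> and \<open>n\<close>, so \<open>\<real>\<^sup>N\<close> is rendered as
  \<^term>\<open>carrier_vec N :: real vec set\<close>, with entries indexed from \<open>0\<close> and \<^const>\<open>scalar_prod\<close> as the
  standard inner product.
\<close>

text \<open>
  Vectors of dimensions \<open>p + 1\<close> and \<open>q + 1\<close> have a convolution of dimension
  \<open>p + q + 1 = (p + 1) + (q + 1) - 1\<close>.
\<close>

definition convolution :: "real vec \<Rightarrow> real vec \<Rightarrow> real vec" where
  "convolution x y = vec (dim_vec x + dim_vec y - 1)
     (\<lambda>i. \<Sum>(i1, i2) \<in> {(i1, i2). i1 < dim_vec x \<and> i2 < dim_vec y \<and> i1 + i2 = i}. x $ i1 * y $ i2)"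

text \<open>The empty convolution product is the unit \<open>(1)\<close> of convolution, a vector of dimension \<open>1\<close>.\<close>

primrec conv_power :: "real vec \<Rightarrow> nat \<Rightarrow> real vec" where
  "conv_power x 0 = vec 1 (\<lambda>_. 1)"
| "conv_power x (Suc m) = convolution x (conv_power x m)"

text \<open>
  The type \<^typ>\<open>real vec\<close> mixes dimensions and is not a \<open>real_vector\<close>, so the library's \<open>convex\<close>
  does not apply; the following is its definition verbatim with the operations on \<^typ>\<open>real vec\<close>.
  As there, the convex hull is taken with the operator \<^const>\<open>hull\<close>. For sets contained in
  \<^term>\<open>carrier_vec N\<close> (which is convex) the hull stays in \<^term>\<open>carrier_vec N\<close>, so addition of
  vectors of different dimensions plays no role.
\<close>

definition convex_vec :: "real vec set \<Rightarrow> bool" where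
  "convex_vec S \<longleftrightarrow>
     (\<forall>x\<in>S. \<forall>y\<in>S. \<forall>u\<ge>0. \<forall>v\<ge>0. u + v = 1 \<longrightarrow> u \<cdot>\<^sub>v x + v \<cdot>\<^sub>v y \<in> S)"

definition dual_cone :: "nat \<Rightarrow> real vec set \<Rightarrow> real vec set" where
  "dual_cone N S = {y \<in> carrier_vec N. \<forall>x\<in>S. scalar_prod y x \<ge> 0}"

definition HPSD :: "nat \<Rightarrow> nat \<Rightarrow> real vec set" where
  "HPSD m n = {v \<in> carrier_vec ((n - 1) * m + 1).
     \<forall>x \<in> carrier_vec n. scalar_prod v (conv_power x m) \<ge> 0}"

definition U :: "nat \<Rightarrow> nat \<Rightarrow> real vec set" where
  "U m n = convex_vec hull {conv_power x m | x. x \<in> carrier_vec n}"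

lemma conv_power_one:
  assumes "dim_vec x > 0"
  shows "conv_power x 1 = x"
proof (rule eq_vecI)
  fix i assume i: "i < dim_vec x"
  have eq: "{(i1, i2). i1 < dim_vec x \<and> i2 < (1::nat) \<and> i1 + i2 = i} = {(i, 0)}"
    using i by auto
  have "conv_power x 1 $ i = (\<Sum>(i1, i2) \<in> {(i1, i2). i1 < dim_vec x \<and> i2 < (1::nat) \<and> i1 + i2 = i}.
      x $ i1 * vec 1 (\<lambda>_. 1) $ i2)"
    using i by (simp only: One_nat_def conv_power.simps convolution_def index_vec dim_vec diff_add_inverse2)
  then show "conv_power x 1 $ i = x $ i"
    unfolding eq by simp
qed (simp add: convolution_def)

lemma conv_power_carrier:
  assumes "x \<in> carrier_vec n" and "n > 0"
  shows "conv_power x m \<in> carrier_vec ((n - 1) * m + 1)"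
proof (rule carrier_vecI)
  obtain k where k: "n = Suc k" using assms(2) by (cases n) simp_all
  have dx: "dim_vec x = Suc k" using assms(1) k by simp
  show "dim_vec (conv_power x m) = (n - 1) * m + 1"
    by (induction m) (simp_all add: convolution_def dx k)
qed

lemma convex_vec_carrier: "convex_vec (carrier_vec N)"
  by (simp add: convex_vec_def)

lemma U_carrier:
  assumes "n > 0"
  shows "U m n \<subseteq> carrier_vec ((n - 1) * m + 1)"
  unfolding U_def
proof (rule hull_minimal)
  show "{conv_power x m |x. x \<in> carrier_vec n} \<subseteq> carrier_vec ((n - 1) * m + 1)"
    using conv_power_carrier[OF _ assms] by blast
qed (rule convex_vec_carrier)

end

theory Submission
  imports Defs "HOL-Analysis.Function_Topology" "HOL-Computational_Algebra.Polynomial"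
begin

text \<open>
  Reading vectors as coefficient sequences, convolution powers become powers of polynomials. Nonnegative
  factors have \<open>m\<close>-th roots, so \<open>U m n\<close> is a convex cone, and by Caratheodory it consists of the
  sums of \<open>N = (n - 1) * m + 1\<close> convolution powers. As \<open>m\<close> is even, evaluating the polynomials
  at \<open>0, \<dots>, n - 1\<close> bounds all summands in terms of their sum. Hence every \<open>z\<close> has a nearest point \<open>u\<close>
  in \<open>U m n\<close>, and if \<open>z \<notin> U m n\<close>, then \<open>u - z\<close> lies in \<open>HPSD m n\<close> and has negative inner product
  with \<open>z\<close>.
\<close>

section \<open>Linear relations and Caratheodory's theorem for cones\<close>

text \<open>Gaussian elimination by induction on the number of equations: the last equation is
  either void or eliminates one unknown, and the unknowns still outnumber the remaining
  equations.\<close>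

lemma homogeneous_system_nontrivial:
  fixes a :: "'j \<Rightarrow> nat \<Rightarrow> real"
  assumes "finite J" "N < card J"
  shows "\<exists>c. (\<exists>j\<in>J. c j \<noteq> 0) \<and> (\<forall>i<N. (\<Sum>j\<in>J. c j * a j i) = 0)"
  using assms
proof (induction N arbitrary: J a)
  case 0
  then have "J \<noteq> {}" by auto
  then show ?case by (intro exI[of _ "\<lambda>_. 1"]) auto
next
  case (Suc N)
  show ?case
  proof (cases "\<forall>j\<in>J. a j N = 0")
    case True
    obtain c where "\<exists>j\<in>J. c j \<noteq> 0" "\<forall>i<N. (\<Sum>j\<in>J. c j * a j i) = 0"
      using Suc.IH[of J a] Suc.prems by auto
    with True show ?thesis
      by (intro exI[of _ c]) (auto simp: less_Suc_eq)
  next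
    case False
    then obtain k where k: "k \<in> J" "a k N \<noteq> 0" by blast
    \<comment> \<open>Eliminates the unknown \<open>k\<close> with the nonzero pivot
      \<open>a k N\<close> of the last equation.\<close>
    define b where "b j i = a j i - a j N / a k N * a k i" for j i
    have "N < card (J - {k})" using Suc.prems k by simp
    then obtain c where c: "\<exists>j\<in>J - {k}. c j \<noteq> 0" "\<forall>i<N. (\<Sum>j\<in>J - {k}. c j * b j i) = 0"
      using Suc.IH[of "J - {k}" b] Suc.prems by auto
    \<comment> \<open>Back substitution: the last equation, solved for the unknown \<open>k\<close>,
      forces the value \<open>- s / a k N\<close>.\<close>
    define s where "s = (\<Sum>j\<in>J - {k}. c j * a j N)"
    define d where "d = c(k := - s / a k N)"
    have sum_d: "(\<Sum>j\<in>J. d j * a j i) = - s / a k N * a k i + (\<Sum>j\<in>J - {k}. c j * a j i)" for i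
      using Suc.prems k by (subst sum.remove[of J k]) (auto simp: d_def intro!: sum.cong)
    have "(\<Sum>j\<in>J. d j * a j i) = 0" if "i < Suc N" for i
    proof (cases "i = N")
      case True
      then show ?thesis unfolding sum_d using k by (simp add: s_def)
    next
      case False
      have "(\<Sum>j\<in>J - {k}. c j * b j i) = (\<Sum>j\<in>J - {k}. c j * a j i) - s / a k N * a k i"
        by (simp add: b_def s_def sum_subtractf sum_divide_distrib sum_distrib_right
            right_diff_distrib mult.assoc)
      then show ?thesis unfolding sum_d using c(2) False that by simp
    qed
    moreover have "\<exists>j\<in>J. d j \<noteq> 0" using c(1) by (auto simp: d_def)
    ultimately show ?thesis by blast
  qed
qed

text \<open>More than \<open>N\<close> vectors in dimension \<open>N\<close> satisfy a linear
  relation. Subtracting a suitable multiple of it from the weights keeps them nonnegative and makes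
  one of them vanish, so the index set shrinks.\<close>

lemma conic_caratheodory:
  fixes f :: "'j \<Rightarrow> nat \<Rightarrow> real"
  assumes "finite J" "\<forall>j\<in>J. 0 \<le> w j"
  shows "\<exists>J'\<subseteq>J. \<exists>w'. card J' \<le> N \<and> (\<forall>j\<in>J'. 0 \<le> w' j) \<and>
           (\<forall>i<N. (\<Sum>j\<in>J'. w' j * f j i) = (\<Sum>j\<in>J. w j * f j i))"
  using assms
proof (induction "card J" arbitrary: J w rule: less_induct)
  case less
  show ?case
  proof (cases "card J \<le> N")
    case True
    then show ?thesis using less.prems by blast
  next
    case False
    then obtain c0 where c0: "\<exists>j\<in>J. c0 j \<noteq> 0" "\<forall>i<N. (\<Sum>j\<in>J. c0 j * f j i) = 0"
      using homogeneous_system_nontrivial[of J N f] less.prems by auto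
    \<comment> \<open>Negating the relation if necessary gives it a positive coefficient, so
      \<open>P\<close> below is nonempty.\<close>
    obtain c where c: "\<exists>j\<in>J. c j > 0" "\<forall>i<N. (\<Sum>j\<in>J. c j * f j i) = 0"
    proof (cases "\<exists>j\<in>J. c0 j > 0")
      case True
      then show ?thesis using that c0 by blast
    next
      case False
      then show ?thesis using c0
        by (intro that[of "\<lambda>j. - c0 j"]) (force simp: sum_negf)+
    qed
    define P where "P = {j\<in>J. c j > 0}"
    have P: "finite P" "P \<noteq> {}" using c less.prems by (auto simp: P_def)
    \<comment> \<open>The largest \<open>t\<close> for which all weights
      \<open>w j - t * c j\<close> stay nonnegative; an index attaining the minimum gets weight
      zero.\<close>
    define t where "t = Min ((\<lambda>j. w j / c j) ` P)"
    have "t \<in> (\<lambda>j. w j / c j) ` P" unfolding t_def using P by (intro Min_in) auto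
    then obtain k where k: "k \<in> P" "t = w k / c k" by blast
    have t_le: "t \<le> w j / c j" if "j \<in> P" for j
      unfolding t_def using P that by (intro Min_le) auto
    have t0: "t \<ge> 0" using k less.prems by (auto simp: P_def)
    define w1 where "w1 j = w j - t * c j" for j
    have w1: "w1 j \<ge> 0" if "j \<in> J" for j
    proof (cases "c j > 0")
      case True
      with that have "t \<le> w j / c j" by (intro t_le) (auto simp: P_def)
      with True show ?thesis by (simp add: w1_def field_simps)
    next
      case False
      then have "t * c j \<le> 0" using t0 by (intro mult_nonneg_nonpos) auto
      then show ?thesis using less.prems(2) that by (force simp: w1_def)
    qed
    have kJ: "k \<in> J" and w1k: "w1 k = 0" using k by (auto simp: P_def w1_def)
    have eq: "(\<Sum>j\<in>J - {k}. w1 j * f j i) = (\<Sum>j\<in>J. w j * f j i)" if "i < N" for i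
    proof -
      have "(\<Sum>j\<in>J. w1 j * f j i) = (\<Sum>j\<in>J. w j * f j i) - t * (\<Sum>j\<in>J. c j * f j i)"
        by (simp add: w1_def left_diff_distrib sum_subtractf sum_distrib_left mult.assoc)
      moreover have "(\<Sum>j\<in>J. w1 j * f j i) = (\<Sum>j\<in>J - {k}. w1 j * f j i)"
        using kJ w1k less.prems(1) by (subst sum.remove[of J k]) auto
      ultimately show ?thesis using c(2) that by simp
    qed
    have "card (J - {k}) < card J"
      using kJ less.prems(1) by (rule card_Diff1_less[rotated])
    from less.hyps[OF this, of w1] less.prems(1) w1
    obtain J' w' where "J' \<subseteq> J - {k}" "card J' \<le> N" "\<forall>j\<in>J'. 0 \<le> w' j"
      "\<forall>i<N. (\<Sum>j\<in>J'. w' j * f j i) = (\<Sum>j\<in>J - {k}. w1 j * f j i)"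
      by auto
    then show ?thesis using eq by (intro exI[of _ J'] conjI exI[of _ w']) auto
  qed
qed

section \<open>Convolution as multiplication of polynomials\<close>

text \<open>The argument is a function, not a vector: coefficient sequences then live in a function
  space with the product topology, where compactness is at hand.\<close>

definition coeffs_poly :: "nat \<Rightarrow> (nat \<Rightarrow> real) \<Rightarrow> real poly" where
  "coeffs_poly n x = (\<Sum>k<n. monom (x k) k)"

lemma coeff_coeffs_poly: "coeff (coeffs_poly n x) i = (if i < n then x i else 0)"
  by (simp add: coeffs_poly_def coeff_sum)

lemma coeffs_poly_mult: "coeffs_poly n (\<lambda>k. c * x k) = smult c (coeffs_poly n x)"
  by (rule poly_eqI) (simp add: coeff_coeffs_poly)

lemma coeffs_poly_zero [simp]: "coeffs_poly n (\<lambda>k. 0) = 0"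
  by (simp add: coeffs_poly_def)

lemma degree_coeffs_poly: "degree (coeffs_poly n x) \<le> n - 1"
  by (rule degree_le) (auto simp: coeff_coeffs_poly)

text \<open>Convolution is the Cauchy product. With positive dimensions, the length
  \<open>dim_vec x + dim_vec y - 1\<close> is a true subtraction and covers all index sums.\<close>

lemma coeffs_poly_convolution:
  assumes "dim_vec x > 0" "dim_vec y > 0"
  shows "coeffs_poly (dim_vec (convolution x y)) (($) (convolution x y)) =
         coeffs_poly (dim_vec x) (($) x) * coeffs_poly (dim_vec y) (($) y)"
proof (rule poly_eqI)
  fix i
  let ?a = "coeff (coeffs_poly (dim_vec x) (($) x))" and ?b = "coeff (coeffs_poly (dim_vec y) (($) y))"
  let ?S = "{(i1, i2). i1 < dim_vec x \<and> i2 < dim_vec y \<and> i1 + i2 = i}"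
  have "(\<Sum>k\<le>i. ?a k * ?b (i - k)) = (\<Sum>(i1, i2)\<in>(\<lambda>k. (k, i - k)) ` {..i}. ?a i1 * ?b i2)"
    by (subst sum.reindex) (auto intro: inj_onI)
  \<comment> \<open>Antidiagonal pairs with a component out of range contribute nothing, as one of
    the coefficients is zero.\<close>
  also have "\<dots> = (\<Sum>(i1, i2)\<in>?S. ?a i1 * ?b i2)"
    by (rule sum.mono_neutral_right) (auto simp: coeff_coeffs_poly image_iff split: if_splits)
  also have "\<dots> = (\<Sum>(i1, i2)\<in>?S. x $ i1 * y $ i2)"
    by (rule sum.cong) (auto simp: coeff_coeffs_poly)
  also have "\<dots> = coeff (coeffs_poly (dim_vec (convolution x y)) (($) (convolution x y))) i"
  proof (cases "i < dim_vec x + dim_vec y - 1")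
    case True
    then show ?thesis by (simp add: coeff_coeffs_poly convolution_def)
  next
    case False
    then have "?S = {}" using assms by auto
    then show ?thesis using False by (simp only: coeff_coeffs_poly convolution_def dim_vec) simp
  qed
  finally show "coeff (coeffs_poly (dim_vec (convolution x y)) (($) (convolution x y))) i =
      coeff (coeffs_poly (dim_vec x) (($) x) * coeffs_poly (dim_vec y) (($) y)) i"
    by (simp add: coeff_mult)
qed

lemma conv_power_eq:
  assumes "x \<in> carrier_vec n" "n > 0"
  shows "conv_power x m = vec ((n - 1) * m + 1) (coeff (coeffs_poly n (($) x) ^ m))"
proof -
  have dim: "dim_vec (conv_power x m) = (n - 1) * m + 1" for m
    using conv_power_carrier[OF assms] by (rule carrier_vecD)
  have n: "dim_vec x = n" using assms by simp
  have poly: "coeffs_poly (dim_vec (conv_power x m)) (($) (conv_power x m)) = coeffs_poly n (($) x) ^ m"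
  proof (induction m)
    case 0
    show ?case by (rule poly_eqI) (simp add: coeff_coeffs_poly)
  next
    case (Suc m)
    then show ?case
      using coeffs_poly_convolution[of x "conv_power x m"] assms n dim[of m] by simp
  qed
  show ?thesis
    by (rule eq_vecI) (simp_all add: dim flip: poly, simp_all add: coeff_coeffs_poly dim)
qed

text \<open>For fixed \<open>t\<close> the value is a linear functional of the coefficient vector of
  the power. Summed over several polynomials, it depends only on the sum of these vectors.\<close>

lemma poly_coeffs_poly_power:
  assumes "n > 0"
  shows "poly (coeffs_poly n x) t ^ m =
    (\<Sum>i<(n - 1) * m + 1. coeff (coeffs_poly n x ^ m) i * t ^ i)"
proof -
  have "degree (coeffs_poly n x ^ m) \<le> (n - 1) * m"
    by (rule order.trans[OF degree_power_le]) (intro mult_right_mono degree_coeffs_poly le0)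
  then have "poly (coeffs_poly n x ^ m) t =
      (\<Sum>i\<le>(n - 1) * m. coeff (coeffs_poly n x ^ m) i * t ^ i)"
    unfolding poly_altdef by (intro sum.mono_neutral_left) (auto simp: coeff_eq_0)
  then show ?thesis by (simp add: lessThan_Suc_atMost)
qed

section \<open>Continuity, compactness and a coercive estimate\<close>

text \<open>Each coefficient of a power is a polynomial expression in the coefficients of the base.
  The parameter space is arbitrary, to serve single sequences as well as families of them.\<close>

lemma continuous_on_coeff_power:
  fixes f :: "'a :: topological_space \<Rightarrow> real poly"
  assumes "\<And>i. continuous_on S (\<lambda>x. coeff (f x) i)"
  shows "continuous_on S (\<lambda>x. coeff (f x ^ m) i)"
proof (induction m arbitrary: i)
  case (Suc m)
  then show ?case by (auto simp: coeff_mult intro!: continuous_intros assms)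
qed simp

lemma continuous_on_coeff_coeffs_poly:
  fixes f :: "'a :: topological_space \<Rightarrow> nat \<Rightarrow> real"
  assumes "\<And>k. continuous_on S (\<lambda>x. f x k)"
  shows "continuous_on S (\<lambda>x. coeff (coeffs_poly n (f x)) i)"
  by (cases "i < n") (auto simp: coeff_coeffs_poly assms)

text \<open>Tychonoff's theorem, for boxes of sequences and, applied twice, for boxes of families of
  sequences.\<close>

lemma compact_PiE_UNIV:
  fixes S :: "'i \<Rightarrow> 'a :: topological_space set"
  assumes "\<And>i. compact (S i)"
  shows "compact (PiE UNIV S)"
  using compactin_PiE[of "\<lambda>_. euclidean" UNIV S] assms
  by (simp add: euclidean_product_topology)

text \<open>
  A nonzero polynomial of degree less than \<open>n\<close> does not vanish at all of \<open>0, \<dots>, n - 1\<close>; compactness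
  and homogeneity turn this into a uniform estimate.
\<close>
lemma sum_even_powers_coercive:
  assumes "even m" "m > 0" "n > 0"
  shows "\<exists>\<delta>>0. \<forall>x. \<delta> * (\<Sum>k<n. \<bar>x k\<bar>) ^ m \<le> (\<Sum>t<n. poly (coeffs_poly n x) (real t) ^ m)"
proof -
  define F where "F x = (\<Sum>t<n. poly (coeffs_poly n x) (real t) ^ m)" for x
  \<comment> \<open>The unit sphere of the 1-norm in the first \<open>n\<close> coordinates; the
    other coordinates are only kept in a compact interval.\<close>
  define K where "K = PiE UNIV (\<lambda>_::nat. {-1..1::real}) \<inter> {x. (\<Sum>k<n. \<bar>x k\<bar>) = 1}"
  have coord: "continuous_on S (\<lambda>x. x k)" for S :: "(nat \<Rightarrow> real) set" and k
    by (rule continuous_on_subset[OF continuous_on_product_coordinates subset_UNIV])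
  have "closed {x::nat \<Rightarrow> real. (\<Sum>k<n. \<bar>x k\<bar>) = 1}"
    by (intro closed_Collect_eq continuous_intros coord)
  then have "compact K"
    unfolding K_def by (intro compact_Int_closed compact_PiE_UNIV) auto
  moreover have "(\<lambda>k. if k = 0 then 1 else 0) \<in> K"
  proof -
    have "\<bar>if k = 0 then 1 else 0\<bar> = (if k = 0 then 1 else (0::real))" for k :: nat
      by simp
    then show ?thesis using assms by (simp add: K_def PiE_UNIV_domain Pi_iff)
  qed
  moreover have "continuous_on K F"
    unfolding F_def poly_coeffs_poly_power[OF assms(3)]
    by (intro continuous_intros continuous_on_coeff_power continuous_on_coeff_coeffs_poly coord)
  ultimately obtain x0 where x0: "x0 \<in> K" "\<And>x. x \<in> K \<Longrightarrow> F x0 \<le> F x"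
    using continuous_attains_inf[of K F] by blast
  have nonneg: "F x \<ge> 0" for x
    unfolding F_def using assms by (intro sum_nonneg) auto
  have "F x0 \<noteq> 0"
  proof
    assume "F x0 = 0"
    then have zero: "poly (coeffs_poly n x0) (real t) = 0" if "t < n" for t
      using that assms by (auto simp: F_def sum_nonneg_eq_0_iff)
    have "coeffs_poly n x0 = 0"
    proof (rule ccontr)
      assume nz: "coeffs_poly n x0 \<noteq> 0"
      have "card (real ` {..<n}) \<le> card {t. poly (coeffs_poly n x0) t = 0}"
        using zero nz by (intro card_mono poly_roots_finite) auto
      also have "\<dots> \<le> n - 1"
        using card_poly_roots_bound[OF nz] degree_coeffs_poly[of n x0] by linarith
      finally show False using assms by (simp add: card_image)
    qed
    then have "x0 k = 0" if "k < n" for k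
      using coeff_coeffs_poly[of n x0 k] that by simp
    then show False using x0(1) by (simp add: K_def)
  qed
  then have pos: "F x0 > 0" using nonneg[of x0] by linarith
  have "F x0 * (\<Sum>k<n. \<bar>x k\<bar>) ^ m \<le> F x" for x
  proof (cases "(\<Sum>k<n. \<bar>x k\<bar>) = 0")
    case True
    then show ?thesis using nonneg assms by (simp add: zero_power)
  next
    case False
    define s where "s = (\<Sum>k<n. \<bar>x k\<bar>)"
    have s: "s > 0" using False by (simp add: s_def less_le sum_nonneg)
    \<comment> \<open>Scales \<open>x\<close> to norm 1 and clears the coordinates from
      \<open>n\<close> on, so that \<open>y\<close> lies in \<open>K\<close>.\<close>
    define y where "y k = (if k < n then x k / s else 0)" for k
    have "\<bar>x k\<bar> \<le> s" if "k < n" for k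
      unfolding s_def using that by (intro member_le_sum) auto
    then have "\<bar>y k\<bar> \<le> 1" for k using s by (auto simp: y_def)
    then have "y k \<in> {-1..1}" for k unfolding atLeastAtMost_iff by (meson abs_le_iff minus_le_iff)
    then have y1: "y \<in> PiE UNIV (\<lambda>_. {-1..1})" by (simp add: PiE_UNIV_domain Pi_iff)
    have "(\<Sum>k<n. \<bar>y k\<bar>) = (\<Sum>k<n. \<bar>x k\<bar> / s)"
      using s by (intro sum.cong) (auto simp: y_def)
    also have "\<dots> = 1" using s by (simp add: s_def flip: sum_divide_distrib)
    finally have "y \<in> K" using y1 by (simp add: K_def)
    have "coeffs_poly n x = coeffs_poly n (\<lambda>k. s * y k)"
      using s by (intro poly_eqI) (simp add: coeff_coeffs_poly y_def)
    then have "F x = s ^ m * F y"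
      unfolding F_def by (simp add: coeffs_poly_mult power_mult_distrib sum_distrib_left)
    moreover have "F x0 * s ^ m \<le> F y * s ^ m"
      using x0(2)[OF \<open>y \<in> K\<close>] s by (intro mult_right_mono) auto
    ultimately show ?thesis by (simp add: s_def mult.commute)
  qed
  then show ?thesis using pos unfolding F_def by blast
qed

section \<open>Sums of a fixed number of powers\<close>

definition power_sum :: "nat \<Rightarrow> nat \<Rightarrow> nat \<Rightarrow> (nat \<Rightarrow> nat \<Rightarrow> real) \<Rightarrow> nat \<Rightarrow> real" where
  "power_sum K m n X i = (\<Sum>j<K. coeff (coeffs_poly n (X j) ^ m) i)"

text \<open>The number of summands is fixed at the ambient dimension \<open>N\<close>, the bound
  from Caratheodory. All elements then come from one parameter space, on which a minimum can be
  sought.\<close>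

definition power_sums :: "nat \<Rightarrow> nat \<Rightarrow> real vec set" where
  "power_sums m n = (let N = (n - 1) * m + 1 in range (\<lambda>X. vec N (power_sum N m n X)))"

lemma conic_combination_in_power_sums:
  assumes "m > 0" "finite J" "\<forall>j\<in>J. 0 \<le> w j"
  shows "vec ((n - 1) * m + 1) (\<lambda>i. \<Sum>j\<in>J. w j * coeff (coeffs_poly n (X j) ^ m) i) \<in> power_sums m n"
proof -
  let ?N = "(n - 1) * m + 1"
  obtain J' w' where J': "J' \<subseteq> J" "card J' \<le> ?N" "\<forall>j\<in>J'. 0 \<le> w' j"
    and eq: "\<forall>i<?N. (\<Sum>j\<in>J'. w' j * coeff (coeffs_poly n (X j) ^ m) i) =
                   (\<Sum>j\<in>J. w j * coeff (coeffs_poly n (X j) ^ m) i)"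
    using conic_caratheodory[OF assms(2,3), where N = ?N and f = "\<lambda>j. coeff (coeffs_poly n (X j) ^ m)"]
    by (elim exE conjE) (rule that)
  have fin: "finite J'" using J' assms(2) finite_subset by blast
  then obtain e where e: "bij_betw e {..<card J'} J'"
    using ex_bij_betw_nat_finite[of J'] by (auto simp: atLeast0LessThan)
  \<comment> \<open>A nonnegative weight moves inside the \<open>m\<close>-th power as its
    \<open>m\<close>-th root; spare slots hold the zero polynomial, whose \<open>m\<close>-th power
    vanishes as \<open>m > 0\<close>.\<close>
  define Y where "Y l = (if l < card J' then \<lambda>k. root m (w' (e l)) * X (e l) k else (\<lambda>k. 0))" for l
  have Y: "coeff (coeffs_poly n (Y l) ^ m) i =
      (if l < card J' then w' (e l) * coeff (coeffs_poly n (X (e l)) ^ m) i else 0)" for l i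
  proof (cases "l < card J'")
    case True
    then have "e l \<in> J'" using e by (auto dest: bij_betwE)
    then show ?thesis using True J'(3) assms(1)
      by (simp add: Y_def coeffs_poly_mult smult_power real_root_pow_pos2)
  next
    case False
    then show ?thesis using assms(1) by (simp add: Y_def zero_power)
  qed
  have "power_sum ?N m n Y i = (\<Sum>j\<in>J'. w' j * coeff (coeffs_poly n (X j) ^ m) i)" for i
  proof -
    have "power_sum ?N m n Y i = (\<Sum>l<card J'. w' (e l) * coeff (coeffs_poly n (X (e l)) ^ m) i)"
      unfolding power_sum_def Y using J'(2) by (intro sum.mono_neutral_cong_right) auto
    also have "\<dots> = (\<Sum>j\<in>J'. w' j * coeff (coeffs_poly n (X j) ^ m) i)"
      by (rule sum.reindex_bij_betw[OF e])
    finally show ?thesis .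
  qed
  then have "vec ?N (\<lambda>i. \<Sum>j\<in>J. w j * coeff (coeffs_poly n (X j) ^ m) i) = vec ?N (power_sum ?N m n Y)"
    using eq by (intro eq_vecI) auto
  then show ?thesis by (auto simp: power_sums_def Let_def)
qed

lemma power_sums_conic_combination:
  assumes "m > 0" "u \<in> power_sums m n" "v \<in> power_sums m n" "a \<ge> 0" "b \<ge> 0"
  shows "a \<cdot>\<^sub>v u + b \<cdot>\<^sub>v v \<in> power_sums m n"
proof -
  let ?N = "(n - 1) * m + 1"
  obtain X Y where u: "u = vec ?N (power_sum ?N m n X)" and v: "v = vec ?N (power_sum ?N m n Y)"
    using assms(2,3) by (auto simp: power_sums_def Let_def)
  \<comment> \<open>Merges both sums over the disjoint union of their index sets; the
    \<open>2 * ?N\<close> terms are then reduced to \<open>?N\<close> by the previous lemma.\<close>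
  have "a \<cdot>\<^sub>v u + b \<cdot>\<^sub>v v = vec ?N (\<lambda>i. \<Sum>j\<in>{..<?N} <+> {..<?N}.
      case_sum (\<lambda>_. a) (\<lambda>_. b) j * coeff (coeffs_poly n (case_sum X Y j) ^ m) i)"
    by (rule eq_vecI) (simp_all add: u v power_sum_def sum.Plus sum_distrib_left distrib_left)
  also have "\<dots> \<in> power_sums m n"
    using assms by (intro conic_combination_in_power_sums) (auto split: sum.split)
  finally show ?thesis .
qed

lemma conv_power_in_power_sums:
  assumes "m > 0" "n > 0" "x \<in> carrier_vec n"
  shows "conv_power x m \<in> power_sums m n"
  using conic_combination_in_power_sums[of m "{()}" "\<lambda>_. 1" n "\<lambda>_. ($) x"] assms
  by (simp add: conv_power_eq)

section \<open>The convex hull as a cone of power sums\<close>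

lemma conv_power_vec:
  assumes "n > 0"
  shows "conv_power (vec n x) m = vec ((n - 1) * m + 1) (coeff (coeffs_poly n x ^ m))"
proof -
  have "coeffs_poly n (($) (vec n x)) = coeffs_poly n x"
    by (rule poly_eqI) (simp add: coeff_coeffs_poly)
  then show ?thesis using conv_power_eq[of "vec n x" n m] assms by simp
qed

lemma convex_vec_U: "convex_vec (U m n)"
  unfolding U_def by (rule hull_in) (auto simp: convex_vec_def)

lemma conv_power_in_U: "x \<in> carrier_vec n \<Longrightarrow> conv_power x m \<in> U m n"
  unfolding U_def by (rule hull_inc) blast

text \<open>Scaling \<open>x\<close> by the \<open>m\<close>-th root of \<open>c\<close> scales its
  convolution power by \<open>c\<close>, which settles the generators; the vectors whose
  \<open>c\<close>-fold lies in \<open>U m n\<close> form a convex set, which settles the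
  hull.\<close>

lemma U_smult:
  assumes "m > 0" "n > 0" "x \<in> U m n" "c \<ge> 0"
  shows "c \<cdot>\<^sub>v x \<in> U m n"
proof -
  let ?N = "(n - 1) * m + 1"
  \<comment> \<open>The dimension is carried through the induction because scaling distributes over
    a sum of vectors of equal dimension.\<close>
  have "x \<in> carrier_vec ?N \<and> c \<cdot>\<^sub>v x \<in> U m n"
    using assms(3) unfolding U_def[of m n]
  proof (rule hull_induct)
    fix y assume "y \<in> {conv_power x m |x. x \<in> carrier_vec n}"
    then obtain x where x: "x \<in> carrier_vec n" and y: "y = conv_power x m" by blast
    have "conv_power (vec n (\<lambda>k. root m c * x $ k)) m = c \<cdot>\<^sub>v y"
      using assms x unfolding y conv_power_vec[OF assms(2)]
      by (intro eq_vecI) (simp_all add: conv_power_eq coeffs_poly_mult smult_power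
          real_root_pow_pos2)
    then show "y \<in> carrier_vec ?N \<and> c \<cdot>\<^sub>v y \<in> convex_vec hull {conv_power x m |x. x \<in> carrier_vec n}"
      using conv_power_in_U[of "vec n (\<lambda>k. root m c * x $ k)" n m] conv_power_carrier[OF x assms(2)] y
      by (auto simp: U_def)
  next
    show "convex_vec {y. y \<in> carrier_vec ?N \<and> c \<cdot>\<^sub>v y \<in> convex_vec hull {conv_power x m |x. x \<in> carrier_vec n}}"
      unfolding convex_vec_def U_def[symmetric]
    proof (intro ballI allI impI)
      fix y z and u v :: real
      assume y: "y \<in> {y. y \<in> carrier_vec ?N \<and> c \<cdot>\<^sub>v y \<in> U m n}"
        and z: "z \<in> {y. y \<in> carrier_vec ?N \<and> c \<cdot>\<^sub>v y \<in> U m n}"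
        and uv: "u \<ge> 0" "v \<ge> 0" "u + v = 1"
      have "c \<cdot>\<^sub>v (u \<cdot>\<^sub>v y + v \<cdot>\<^sub>v z) = u \<cdot>\<^sub>v (c \<cdot>\<^sub>v y) + v \<cdot>\<^sub>v (c \<cdot>\<^sub>v z)"
        using y z by (intro eq_vecI) (auto simp: algebra_simps)
      also have "\<dots> \<in> U m n"
        using convex_vec_U[of m n] y z uv unfolding convex_vec_def by blast
      finally show "u \<cdot>\<^sub>v y + v \<cdot>\<^sub>v z \<in> {y. y \<in> carrier_vec ?N \<and> c \<cdot>\<^sub>v y \<in> U m n}"
        using y z by auto
    qed
  qed
  then show ?thesis by blast
qed

lemma U_add:
  assumes "m > 0" "n > 0" "x \<in> U m n" "y \<in> U m n"
  shows "x + y \<in> U m n"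
proof -
  have dim: "dim_vec x = dim_vec y"
    using U_carrier[OF assms(2), of m] assms(3,4) by (metis carrier_vecD subsetD)
  \<comment> \<open>The sum is the midpoint of the doubled vectors.\<close>
  have "x + y = (1/2) \<cdot>\<^sub>v (2 \<cdot>\<^sub>v x) + (1/2) \<cdot>\<^sub>v (2 \<cdot>\<^sub>v y)"
    by (intro eq_vecI) (auto simp: dim)
  also have "\<dots> \<in> U m n"
    using convex_vec_U[of m n] U_smult[OF assms(1,2,3), of 2] U_smult[OF assms(1,2,4), of 2]
    unfolding convex_vec_def by (auto simp del: smult_smult_assoc)
  finally show ?thesis .
qed

text \<open>The power sums form a convex set containing the generators, hence the hull; conversely,
  the hull is closed under addition.\<close>

lemma U_eq_power_sums:
  assumes "m > 0" "n > 0"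
  shows "U m n = power_sums m n"
proof
  have "convex_vec (power_sums m n)"
    using power_sums_conic_combination[OF assms(1)] by (auto simp: convex_vec_def)
  then show "U m n \<subseteq> power_sums m n"
    unfolding U_def using conv_power_in_power_sums[OF assms] by (intro hull_minimal) auto
next
  let ?N = "(n - 1) * m + 1"
  \<comment> \<open>The number of summands \<open>K\<close> is freed from the dimension
    \<open>?N\<close> to allow induction; the empty sum is the convolution power of the zero
    vector.\<close>
  have "vec ?N (power_sum K m n X) \<in> U m n" for K X
  proof (induction K)
    case 0
    have "vec ?N (power_sum 0 m n X) = conv_power (vec n (\<lambda>_. 0)) m"
      unfolding conv_power_vec[OF assms(2)] using assms
      by (intro eq_vecI) (simp_all add: power_sum_def zero_power)
    then show ?case using conv_power_in_U by simp
  next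
    case (Suc K)
    have "vec ?N (power_sum (Suc K) m n X) = vec ?N (power_sum K m n X) + conv_power (vec n (X K)) m"
      unfolding conv_power_vec[OF assms(2)] by (intro eq_vecI) (simp_all add: power_sum_def)
    then show ?case using U_add[OF assms Suc.IH conv_power_in_U[of "vec n (X K)"]] by simp
  qed
  then show "power_sums m n \<subseteq> U m n" by (auto simp: power_sums_def Let_def)
qed

section \<open>The dual cone of the hull\<close>

lemma convex_vec_halfspace:
  "convex_vec {x \<in> carrier_vec N. scalar_prod v x \<ge> 0}"
  unfolding convex_vec_def
proof (intro ballI allI impI)
  fix x y and a b :: real
  assume x: "x \<in> {x \<in> carrier_vec N. scalar_prod v x \<ge> 0}"
    and y: "y \<in> {x \<in> carrier_vec N. scalar_prod v x \<ge> 0}" and ab: "a \<ge> 0" "b \<ge> 0"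
  have "dim_vec x = N" "dim_vec y = N" using x y by auto
  then have "scalar_prod v (a \<cdot>\<^sub>v x + b \<cdot>\<^sub>v y) = a * scalar_prod v x + b * scalar_prod v y"
    by (simp add: scalar_prod_def sum_distrib_left algebra_simps flip: sum.distrib)
  then show "a \<cdot>\<^sub>v x + b \<cdot>\<^sub>v y \<in> {x \<in> carrier_vec N. scalar_prod v x \<ge> 0}"
    using x y ab by simp
qed

text \<open>A linear inequality valid on the generators defines a half-space, which is convex and so
  contains the hull.\<close>

lemma dual_cone_U:
  assumes "n > 0"
  shows "dual_cone ((n - 1) * m + 1) (U m n) = HPSD m n"
proof
  show "dual_cone ((n - 1) * m + 1) (U m n) \<subseteq> HPSD m n"
    using conv_power_in_U by (auto simp: dual_cone_def HPSD_def)
next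
  have "U m n \<subseteq> {x \<in> carrier_vec ((n - 1) * m + 1). scalar_prod v x \<ge> 0}" if "v \<in> HPSD m n" for v
    unfolding U_def using that conv_power_carrier[OF _ assms]
    by (intro hull_minimal convex_vec_halfspace) (auto simp: HPSD_def)
  then show "HPSD m n \<subseteq> dual_cone ((n - 1) * m + 1) (U m n)"
    by (auto simp: dual_cone_def HPSD_def)
qed

section \<open>Existence of a nearest power sum\<close>

text \<open>The threshold is the squared distance from \<open>z\<close> to the zero sum. Below it
  the power sum is bounded, and even powers cannot cancel each other, so every summand is bounded
  too.\<close>

lemma power_sum_coercive:
  assumes "even m" "m > 0" "n > 0"
  shows "\<exists>B. \<forall>X. (\<Sum>i<(n - 1) * m + 1. (z i - power_sum K m n X i)\<^sup>2) \<le> (\<Sum>i<(n - 1) * m + 1. (z i)\<^sup>2) \<longrightarrow>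
           (\<forall>j<K. \<forall>k<n. \<bar>X j k\<bar> \<le> B)"
proof -
  let ?N = "(n - 1) * m + 1"
  obtain \<delta> where \<delta>: "\<delta> > 0"
    "\<And>x. \<delta> * (\<Sum>k<n. \<bar>x k\<bar>) ^ m \<le> (\<Sum>t<n. poly (coeffs_poly n x) (real t) ^ m)"
    using sum_even_powers_coercive[OF assms] by blast
  define R where "R = (\<Sum>i<?N. (z i)\<^sup>2)"
  \<comment> \<open>\<open>c i\<close> is the weight of entry \<open>i\<close> when the values at
    \<open>0, \<dots>, n - 1\<close> are added up; \<open>C\<close> bounds this total for every
    power sum within the threshold.\<close>
  define c where "c i = (\<Sum>t<n. real t ^ i)" for i
  define C where "C = (\<Sum>i<?N. (\<bar>z i\<bar> + (1 + R)) * c i)"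
  have c0: "c i \<ge> 0" for i by (simp add: c_def sum_nonneg)
  have "\<bar>X j k\<bar> \<le> max 1 (C / \<delta>)"
    if le: "(\<Sum>i<?N. (z i - power_sum K m n X i)\<^sup>2) \<le> R" and j: "j < K" and k: "k < n" for X j k
  proof -
    define s where "s l = (\<Sum>k<n. \<bar>X l k\<bar>)" for l
    have s0: "s l \<ge> 0" for l by (simp add: s_def sum_nonneg)
    have bound: "power_sum K m n X i \<le> \<bar>z i\<bar> + (1 + R)" if "i < ?N" for i
    proof -
      define d where "d = z i - power_sum K m n X i"
      have "d\<^sup>2 \<le> (\<Sum>i<?N. (z i - power_sum K m n X i)\<^sup>2)"
        unfolding d_def using that by (intro member_le_sum) auto
      with le have "d\<^sup>2 \<le> R" by linarith
      \<comment> \<open>Bounds the absolute value of \<open>d\<close> by its square without taking a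
        root.\<close>
      moreover have "0 \<le> (\<bar>d\<bar> - 1)\<^sup>2" by simp
      then have "2 * \<bar>d\<bar> \<le> d\<^sup>2 + 1" by (simp add: power2_diff)
      ultimately have "\<bar>d\<bar> \<le> 1 + R" by linarith
      then show ?thesis unfolding d_def by linarith
    qed
    have "\<delta> * s j ^ m \<le> (\<Sum>l<K. \<delta> * s l ^ m)"
      using j \<delta>(1) s0 by (intro member_le_sum) auto
    also have "\<dots> \<le> (\<Sum>l<K. \<Sum>t<n. poly (coeffs_poly n (X l)) (real t) ^ m)"
      unfolding s_def by (intro sum_mono \<delta>(2))
    also have "\<dots> = (\<Sum>l<K. \<Sum>i<?N. \<Sum>t<n. coeff (coeffs_poly n (X l) ^ m) i * real t ^ i)"
      unfolding poly_coeffs_poly_power[OF assms(3)] by (intro sum.cong refl sum.swap)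
    also have "\<dots> = (\<Sum>i<?N. power_sum K m n X i * c i)"
      unfolding power_sum_def c_def sum_product by (rule sum.swap)
    also have "\<dots> \<le> C"
      unfolding C_def by (intro sum_mono mult_right_mono bound c0) auto
    finally have sm: "s j ^ m \<le> C / \<delta>" using \<delta>(1) by (simp add: field_simps)
    have "s j \<le> max 1 (C / \<delta>)"
    proof (cases "s j \<le> 1")
      case False
      then have "s j \<le> s j ^ m" using assms(2) self_le_power[of "s j" m] by simp
      then show ?thesis using sm by linarith
    qed simp
    moreover have "\<bar>X j k\<bar> \<le> s j" unfolding s_def using k by (intro member_le_sum) auto
    ultimately show ?thesis by linarith
  qed
  then show ?thesis unfolding R_def by blast
qed

lemma power_sum_nearest:
  assumes "even m" "m > 0" "n > 0"
  shows "\<exists>X0. \<forall>X. (\<Sum>i<(n - 1) * m + 1. (z i - power_sum K m n X0 i)\<^sup>2)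
                \<le> (\<Sum>i<(n - 1) * m + 1. (z i - power_sum K m n X i)\<^sup>2)"
proof -
  let ?N = "(n - 1) * m + 1"
  define F where "F X = (\<Sum>i<?N. (z i - power_sum K m n X i)\<^sup>2)" for X
  obtain B where B: "\<And>X j k. F X \<le> (\<Sum>i<?N. (z i)\<^sup>2) \<Longrightarrow> j < K \<Longrightarrow> k < n \<Longrightarrow> \<bar>X j k\<bar> \<le> B"
    using power_sum_coercive[OF assms, of z K] unfolding F_def by blast
  have F0: "F (\<lambda>_ _. 0) = (\<Sum>i<?N. (z i)\<^sup>2)"
    using assms by (simp add: F_def power_sum_def zero_power)
  \<comment> \<open>The absolute value of \<open>B\<close> ensures that the box contains the zero
    family.\<close>
  define Q where "Q = PiE UNIV (\<lambda>_::nat. PiE UNIV (\<lambda>_::nat. {- \<bar>B\<bar>..\<bar>B\<bar>}))"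
  have "compact Q" unfolding Q_def by (intro compact_PiE_UNIV) auto
  moreover have zero_in: "(\<lambda>_ _. 0) \<in> Q" by (simp add: Q_def PiE_UNIV_domain Pi_iff)
  moreover have "continuous_on Q F"
  proof -
    have "continuous_on Q (\<lambda>X. X j k)" for j k
      by (rule continuous_on_product_then_coordinatewise,
          rule continuous_on_product_then_coordinatewise) (rule continuous_on_id)
    then show ?thesis
      unfolding F_def power_sum_def
      by (intro continuous_intros continuous_on_coeff_power continuous_on_coeff_coeffs_poly)
  qed
  ultimately obtain X0 where X0: "X0 \<in> Q" "\<And>X. X \<in> Q \<Longrightarrow> F X0 \<le> F X"
    using continuous_attains_inf[of Q F] by blast
  have "F X0 \<le> F X" for X
  proof (cases "F X \<le> F (\<lambda>_ _. 0)")
    case True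
    \<comment> \<open>Clearing the entries that do not enter \<open>F\<close> keeps its value and
      brings the family into the box.\<close>
    define Y where "Y j k = (if j < K \<and> k < n then X j k else 0)" for j k
    have "coeffs_poly n (Y j) = coeffs_poly n (X j)" if "j < K" for j
      using that by (intro poly_eqI) (simp add: coeff_coeffs_poly Y_def)
    then have "F Y = F X" by (simp add: F_def power_sum_def)
    have "\<bar>Y j k\<bar> \<le> \<bar>B\<bar>" for j k
      using B[OF True[unfolded F0], of j k] by (auto simp: Y_def)
    then have "Y j k \<in> {- \<bar>B\<bar>..\<bar>B\<bar>}" for j k unfolding atLeastAtMost_iff by (meson abs_le_iff minus_le_iff)
    then have "Y \<in> Q" by (simp add: Q_def PiE_UNIV_domain Pi_iff)
    then show ?thesis using X0(2) \<open>F Y = F X\<close> by metis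
  next
    case False
    then show ?thesis using X0(2)[OF zero_in] by linarith
  qed
  then show ?thesis unfolding F_def by blast
qed

section \<open>Separation by the nearest point\<close>

text \<open>After division by \<open>t\<close>, the linear coefficient dominates for small
  \<open>t\<close>. Only \<open>t \<le> 1\<close> is assumed, since a move from \<open>u\<close>
  towards the origin is known to stay in the cone only that far.\<close>

lemma nonneg_if_quadratic_nonneg:
  fixes a b :: real
  assumes "\<And>t. 0 < t \<Longrightarrow> t \<le> 1 \<Longrightarrow> 0 \<le> 2 * t * a + t\<^sup>2 * b"
  shows "a \<ge> 0"
proof (rule ccontr)
  assume "\<not> a \<ge> 0"
  \<comment> \<open>Small enough that \<open>t * b \<le> - a\<close>, which makes
    \<open>2 * a + t * b\<close> negative.\<close>
  define t where "t = min 1 (- a / (\<bar>b\<bar> + 1))"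
  have t: "0 < t" "t \<le> 1" using \<open>\<not> a \<ge> 0\<close> by (auto simp: t_def divide_neg_pos)
  have "t \<le> - a / (\<bar>b\<bar> + 1)" by (simp add: t_def)
  then have "t * (\<bar>b\<bar> + 1) \<le> - a" by (subst (asm) pos_le_divide_eq) auto
  moreover have "t * b \<le> t * (\<bar>b\<bar> + 1)" using t by (intro mult_left_mono) auto
  ultimately have "2 * a + t * b < 0" using \<open>\<not> a \<ge> 0\<close> by linarith
  then have "t * (2 * a + t * b) < 0" using t by (intro mult_pos_neg) auto
  then show False using assms[OF t] by (simp add: algebra_simps power2_eq_square)
qed

text \<open>No feasible direction \<open>d\<close> at the nearest point \<open>u\<close> decreases
  the distance, so \<open>v = u - z\<close> has nonnegative inner product with \<open>d\<close>. The
  generators as directions put \<open>v\<close> into \<open>HPSD m n\<close>.\<close>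

lemma U_separation:
  assumes "even m" "m > 0" "n > 0" "z \<in> carrier_vec ((n - 1) * m + 1)" "z \<notin> U m n"
  shows "\<exists>v\<in>HPSD m n. scalar_prod v z < 0"
proof -
  let ?N = "(n - 1) * m + 1"
  obtain X0 where X0: "\<And>X. (\<Sum>i<?N. (z $ i - power_sum ?N m n X0 i)\<^sup>2)
                          \<le> (\<Sum>i<?N. (z $ i - power_sum ?N m n X i)\<^sup>2)"
    using power_sum_nearest[OF assms(1-3), of "($) z" ?N] by blast
  define u where "u = vec ?N (power_sum ?N m n X0)"
  have uU: "u \<in> U m n" using U_eq_power_sums[OF assms(2,3)] by (auto simp: u_def power_sums_def Let_def)
  have u: "u \<in> carrier_vec ?N" by (simp add: u_def)
  define v where "v = u - z"
  have v: "v \<in> carrier_vec ?N" using u assms(4) unfolding v_def by (rule minus_carrier_vec)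
  have near: "(\<Sum>i<?N. (v $ i)\<^sup>2) \<le> (\<Sum>i<?N. (w $ i - z $ i)\<^sup>2)" if "w \<in> U m n" for w
  proof -
    obtain X where "w = vec ?N (power_sum ?N m n X)"
      using \<open>w \<in> U m n\<close> U_eq_power_sums[OF assms(2,3)] by (auto simp: power_sums_def Let_def)
    then show ?thesis using X0[of X] assms(4) by (simp add: v_def u_def power2_commute)
  qed
  have first_order: "scalar_prod v d \<ge> 0"
    if d: "d \<in> carrier_vec ?N" and dU: "\<And>t. 0 < t \<Longrightarrow> t \<le> 1 \<Longrightarrow> u + t \<cdot>\<^sub>v d \<in> U m n" for d
  proof -
    have "0 \<le> 2 * t * scalar_prod v d + t\<^sup>2 * (\<Sum>i<?N. (d $ i)\<^sup>2)" if "0 < t" "t \<le> 1" for t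
    proof -
      have "(\<Sum>i<?N. ((u + t \<cdot>\<^sub>v d) $ i - z $ i)\<^sup>2) =
          (\<Sum>i<?N. (v $ i)\<^sup>2 + (2 * t * (v $ i * d $ i) + t\<^sup>2 * (d $ i)\<^sup>2))"
        using d u assms(4)
        by (intro sum.cong) (auto simp: v_def power2_eq_square algebra_simps)
      also have "\<dots> = (\<Sum>i<?N. (v $ i)\<^sup>2) + (2 * t * scalar_prod v d + t\<^sup>2 * (\<Sum>i<?N. (d $ i)\<^sup>2))"
        using d by (simp add: scalar_prod_def sum.distrib sum_distrib_left distrib_left atLeast0LessThan)
      finally show ?thesis using near[OF dU[OF that]] by simp
    qed
    then show ?thesis by (rule nonneg_if_quadratic_nonneg)
  qed
  have "v \<in> HPSD m n"
    unfolding HPSD_def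
  proof (intro CollectI conjI ballI v)
    fix x :: "real vec" assume x: "x \<in> carrier_vec n"
    show "scalar_prod v (conv_power x m) \<ge> 0"
      using conv_power_carrier[OF x assms(3)]
      by (rule first_order) (intro U_add U_smult conv_power_in_U uU assms x, simp)
  qed
  moreover have "scalar_prod v z < 0"
  proof -
    \<comment> \<open>The direction towards the origin shows that \<open>v\<close> has inner product
      at most 0 with \<open>u\<close>; as \<open>z = u - v\<close>, the product with
      \<open>z\<close> is smaller by the squared norm of \<open>v\<close>, which is
      positive.\<close>
    have "scalar_prod v (- u) \<ge> 0"
    proof (rule first_order)
      fix t :: real assume "0 < t" "t \<le> 1"
      moreover have "u + t \<cdot>\<^sub>v (- u) = (1 - t) \<cdot>\<^sub>v u"
        by (intro eq_vecI) (auto simp: algebra_simps)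
      ultimately show "u + t \<cdot>\<^sub>v (- u) \<in> U m n" using U_smult[OF assms(2,3) uU] by simp
    qed (use u in simp)
    moreover have "scalar_prod v (- u) = - (\<Sum>i<?N. v $ i * u $ i)"
      using u by (simp add: scalar_prod_def atLeast0LessThan sum_negf)
    moreover have "scalar_prod v z = (\<Sum>i<?N. v $ i * u $ i) - (\<Sum>i<?N. (v $ i)\<^sup>2)"
      unfolding scalar_prod_def sum_subtractf[symmetric] using u assms(4)
      by (intro sum.cong) (auto simp: v_def power2_eq_square algebra_simps)
    moreover have "(\<Sum>i<?N. (v $ i)\<^sup>2) > 0"
    proof -
      have "u \<noteq> z" using uU assms(5) by blast
      then obtain i where "i < ?N" "v $ i \<noteq> 0"
        using u assms(4) by (auto simp: v_def vec_eq_iff)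
      then show ?thesis by (intro sum_pos2[of _ i]) auto
    qed
    ultimately show ?thesis by linarith
  qed
  ultimately show ?thesis by blast
qed

theorem theorem1:
  fixes m n :: nat
  assumes "m > 0" and "even m" and "n > 0"
  shows "dual_cone ((n - 1) * m + 1) (U m n) = HPSD m n
       \<and> dual_cone ((n - 1) * m + 1) (HPSD m n) = U m n"
proof
  let ?N = "(n - 1) * m + 1"
  show dual: "dual_cone ?N (U m n) = HPSD m n" using assms(3) by (rule dual_cone_U)
  show "dual_cone ?N (HPSD m n) = U m n"
  proof
    show "dual_cone ?N (HPSD m n) \<subseteq> U m n"
    proof
      fix z assume z: "z \<in> dual_cone ?N (HPSD m n)"
      show "z \<in> U m n"
      proof (rule ccontr)
        assume "z \<notin> U m n"
        then obtain v where "v \<in> HPSD m n" "scalar_prod v z < 0"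
          using U_separation[of m n z] assms z by (auto simp: dual_cone_def)
        moreover have "scalar_prod v z = scalar_prod z v"
          using z \<open>v \<in> HPSD m n\<close> by (intro comm_scalar_prod[of _ ?N]) (auto simp: dual_cone_def HPSD_def)
        ultimately show False using z by (force simp: dual_cone_def)
      qed
    qed
  next
    show "U m n \<subseteq> dual_cone ?N (HPSD m n)"
    proof
      fix x assume x: "x \<in> U m n"
      then have xN: "x \<in> carrier_vec ?N" using U_carrier[OF assms(3)] by blast
      have "scalar_prod x v \<ge> 0" if "v \<in> HPSD m n" for v
      proof -
        \<comment> \<open>The first identity already pairs \<open>v\<close> with every element of
          \<open>U m n\<close>; symmetry of the inner product does the rest.\<close>
        have "v \<in> dual_cone ?N (U m n)" using that dual by simp
        then show ?thesis using x comm_scalar_prod[of v ?N x] xN by (auto simp: dual_cone_def)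
      qed
      with xN show "x \<in> dual_cone ?N (HPSD m n)" by (simp add: dual_cone_def)
    qed
  qed
qed

end
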